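(* Suppose that $w$ is a (nonempty, finite or infinite) binary word and $k$ is a positive integer. Then $\mathrm{cexp}(h_k(w))=\mathrm{cexp}(w)$ if $\mathrm{cexp}(w)\ge 3$, and $\mathrm{cexp}(h_k(w))\le 3$ if $\mathrm{cexp}(w)<3$.
   Context: Words are over $\{0,1\}$ and indexed from $0$; $w[i..j]=w[i]w[i+1]\cdots w[j]$. A factor is a contiguous sub-block. The complement $\overline{w}$ of a binary word $w$ is obtained by exchanging $0$ and $1$ letterwise. For a finite nonempty word $w$ of length $n$, an integer $p$ with $1\le p\le n$ is a period of $w$ if $w[i]=w[i+p]$ for $0\le i<n-p$; $\mathrm{per}(w)$ is the smallest period, and $\exp(w)=n/\mathrm{per}(w)$. The critical exponent $\mathrm{cexp}(w)$ of a finite or infinite word $w$ is the supremum (possibly $\infty$) of $\exp(x)$ over all finite nonempty factors $x$ of $w$. The Thue--Morse word $\mathbf{t}=0110100110010110\cdots$ is the infinite fixed point starting with $0$ of the morphism $\mu:0\mapsto 01,\ 1\mapsto 10$. For an integer $k\ge1$, the truncated Thue--Morse morphism $h_k$ is the morphism on $\{0,1\}$ with $h_k(0)=\mathbf{t}[0..k-1]$ and $h_k(1)=\overline{\mathbf{t}[0..k-1]}$. *)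

theory Defs
  imports Complex_Main "HOL-Library.Extended_Real" "HOL-Library.Stream" "HOL-Library.Sublist"
begin

text \<open>
  Binary words are words over \<^typ>\<open>bool\<close>, with \<^const>\<open>False\<close> for the letter 0 and \<^const>\<open>True\<close>
  for the letter 1; the complement of a word is obtained by mapping \<^const>\<open>Not\<close>.
\<close>

datatype 'a fiword = Fin "'a list" | Inf "'a stream"

primrec factors :: "'a fiword \<Rightarrow> 'a list set" where
  "factors (Fin w) = {x. sublist x w}"
| "factors (Inf w) = {stake n (sdrop i w) | i n. True}"

definition is_period :: "'a list \<Rightarrow> nat \<Rightarrow> bool" where
  "is_period w p \<longleftrightarrow> 1 \<le> p \<and> p \<le> length w \<and> (\<forall>i < length w - p. w ! i = w ! (i + p))"

definition per :: "'a list \<Rightarrow> nat" where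
  "per w = (LEAST p. is_period w p)"

definition word_exp :: "'a list \<Rightarrow> real" where
  "word_exp w = real (length w) / real (per w)"

definition cexp :: "'a fiword \<Rightarrow> ereal" where
  "cexp w = (SUP x \<in> factors w - {[]}. ereal (word_exp x))"

text \<open>
  A morphism is given by the images of the letters. On infinite words the definition is meaningful
  for non-erasing morphisms only (\<^const>\<open>flat\<close> is unspecified if empty lists occur); all morphisms
  used here are non-erasing.
\<close>

primrec morph :: "('a \<Rightarrow> 'b list) \<Rightarrow> 'a fiword \<Rightarrow> 'b fiword" where
  "morph f (Fin w) = Fin (concat (map f w))"
| "morph f (Inf w) = Inf (flat (smap f w))"

definition tm_morph :: "bool \<Rightarrow> bool list" where
  "tm_morph a = (if a then [True, False] else [False, True])"

definition thue_morse :: "bool stream" where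
  "thue_morse = (THE s. morph tm_morph (Inf s) = Inf s \<and> shd s = False)"

definition trunc_tm :: "nat \<Rightarrow> bool \<Rightarrow> bool list" where
  "trunc_tm k a = (if a then map Not (stake k thue_morse) else stake k thue_morse)"

text \<open>The description of \<^const>\<open>thue_morse\<close> is proper: there is exactly one such fixed point.\<close>

lemma flat_smap_tm_morph_snth:
  "flat (smap tm_morph s) !! n = (s !! (n div 2) \<noteq> odd n)"
proof (induction n arbitrary: s rule: less_induct)
  case (less n)
  obtain a u where s: "s = a ## u" by (cases s)
  have unfold: "flat (smap tm_morph s) = a ## (\<not> a) ## flat (smap tm_morph u)"
    by (simp add: tm_morph_def s)
  consider "n = 0" | "n = 1" | m where "n = Suc (Suc m)"
    by (metis One_nat_def not0_implies_Suc)
  then show ?case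
  proof cases
    case 1
    then show ?thesis unfolding unfold by (simp add: s)
  next
    case 2
    then show ?thesis unfolding unfold by (simp add: s)
  next
    case 3
    then show ?thesis unfolding unfold using less.IH[of m u] by (simp add: s)
  qed
qed

lemma stream_eq_iff_snth: "s = s' \<longleftrightarrow> (\<forall>n. s !! n = s' !! n)"
  using smap_alt[of id s s'] by (simp add: stream.map_id)

lemma thue_morse_ex1:
  "\<exists>!s. morph tm_morph (Inf s) = Inf s \<and> shd s = False"
proof -
  have fix_iff: "morph tm_morph (Inf s) = Inf s \<longleftrightarrow> (\<forall>n. s !! n = (s !! (n div 2) \<noteq> odd n))" for s
    by (auto simp: stream_eq_iff_snth flat_smap_tm_morph_snth)
  define P :: "(nat \<Rightarrow> bool) \<Rightarrow> nat \<Rightarrow> bool"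
    where "P = (\<lambda>f n. if n = 0 then False else (f (n div 2) \<noteq> odd n))"
  define t where "t = wfrec less_than P"
  have adm: "adm_wf less_than P"
    by (auto simp: adm_wf_def P_def)
  have "t = P t"
    unfolding t_def by (rule wfrec_fixpoint[OF wf_less_than adm])
  then have t: "t n = (if n = 0 then False else (t (n div 2) \<noteq> odd n))" for n
    unfolding P_def by (rule fun_cong)
  show ?thesis
  proof (rule ex1I)
    show "morph tm_morph (Inf (smap t nats)) = Inf (smap t nats) \<and> shd (smap t nats) = False"
    proof
      show "morph tm_morph (Inf (smap t nats)) = Inf (smap t nats)"
        unfolding fix_iff
      proof
        fix n show "smap t nats !! n = (smap t nats !! (n div 2) \<noteq> odd n)"
          using t[of n] by (cases "n = 0") simp_all
      qed
      show "shd (smap t nats) = False" using t[of 0] by simp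
    qed
  next
    fix s assume s: "morph tm_morph (Inf s) = Inf s \<and> shd s = False"
    then have rec: "s !! n = (s !! (n div 2) \<noteq> odd n)" for n
      unfolding fix_iff by blast
    have "s !! n = t n" for n
    proof (induction n rule: less_induct)
      case (less n)
      show ?case
      proof (cases "n = 0")
        case True then show ?thesis using s t[of 0] by simp
      next
        case False
        then have "s !! (n div 2) = t (n div 2)" using less by simp
        then show ?thesis using rec[of n] t[of n] False by simp
      qed
    qed
    then show "s = smap t nats" by (simp add: stream_eq_iff_snth)
  qed
qed

end

theory Submission imports Defs begin

text \<open>
  Write \<open>h\<close> for the morphism \<open>trunc_tm k\<close>. Applying \<open>h\<close> to a factor of \<open>w\<close> multiplies its
  length and its periods by \<open>k\<close>, so \<open>cexp w \<le> cexp (h w)\<close>. The theorem follows once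
  \<open>cexp (h w) \<le> max 3 (cexp w)\<close> is known.

  The reason for the second inequality is that a period \<open>p\<close> of a factor of \<open>h w\<close> with more than
  \<open>3 p\<close> letters is a multiple of \<open>k\<close> (\<open>cube_period_dvd\<close>). Indeed, if \<open>p = k q\<close>, then the
  period shifts blocks onto blocks. The two possible blocks differ in every letter, so a single
  common letter forces two blocks to be equal, and the blocks that the factor meets, even those that
  it meets only partly, come from a factor of \<open>w\<close> with period \<open>q\<close> and at least the same exponent
  (\<open>periodic_between_unblock\<close>).

  The proof of the divisibility rests on parity: in a concatenation of the words \<open>01\<close> and \<open>10\<close>, two
  equal adjacent letters can start only at an odd position. In \<open>t\<close>, and in each block, they start
  at an odd offset, and every block of length at least 3 has such a pair at offset 1, since \<open>t\<close>
  starts with \<open>011\<close>.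

  For even \<open>k = 2 m\<close> the morphism factors as \<open>\<mu>\<close> after the truncated morphism for \<open>m\<close>. Parity
  rules out odd periods, even ones are halved by undoing \<open>\<mu>\<close>, and the claim is reduced to \<open>m\<close>. The
  same argument shows that \<open>t\<close> is overlap-free.

  For odd \<open>k\<close> adjacent blocks start at positions of different parity. This makes \<open>h\<close>
  synchronizing: a block occurs in a concatenation of blocks only as one of them
  (\<open>tm_block_synchronizes\<close>). So if the factor contains a whole block together with its translate by
  \<open>p\<close>, to either side, then \<open>k\<close> divides \<open>p\<close>. Otherwise the factor is short compared with \<open>k\<close> and
  meets at most three blocks. It cannot lie inside one block because \<open>t\<close> is overlap-free; for two
  or three blocks, the translates of the pairs at offset 1 have the wrong parity
  (\<open>cube_period_odd\<close>).
\<close>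

section \<open>Periods and block codings\<close>

definition periodic_between :: "(nat \<Rightarrow> 'a) \<Rightarrow> nat \<Rightarrow> nat \<Rightarrow> nat \<Rightarrow> bool" where
  "periodic_between f a b p \<longleftrightarrow> (\<forall>j. a \<le> j \<and> j + p \<le> b \<longrightarrow> f j = f (j + p))"

text \<open>
  The image of the infinite word \<open>g\<close> under the morphism that maps 0 to the prefix of \<open>u\<close> of
  length \<open>k\<close> and 1 to the complement of this prefix. With Thue--Morse for \<open>u\<close> it is the truncated
  Thue--Morse morphism; Thue--Morse for \<open>u\<close> and \<open>k = 2\<close> give \<open>\<mu>\<close>.
\<close>

definition blocks :: "nat \<Rightarrow> (nat \<Rightarrow> bool) \<Rightarrow> (nat \<Rightarrow> bool) \<Rightarrow> nat \<Rightarrow> bool" where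
  "blocks k u g j \<longleftrightarrow> u (j mod k) \<noteq> g (j div k)"

lemma periodic_betweenD:
  "periodic_between f a b p \<Longrightarrow> a \<le> j \<Longrightarrow> j + p \<le> b \<Longrightarrow> f (j + p) = f j"
  by (simp add: periodic_between_def)

lemma periodic_between_subset:
  "periodic_between f a b p \<Longrightarrow> a \<le> a' \<Longrightarrow> b' \<le> b \<Longrightarrow> periodic_between f a' b' p"
  by (simp add: periodic_between_def)

lemma blocks_at: "r < k \<Longrightarrow> blocks k u g (k * c + r) \<longleftrightarrow> u r \<noteq> g c"
  by (simp add: blocks_def)

text \<open>
  The two blocks differ in every position, so one position whose translate by \<open>k q\<close> is still in
  the window decides that the block \<open>l\<close> equals the block \<open>l + q\<close>. Blocks that the window meets only
  partly are included, which is why the conclusion covers the whole range of block indices.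
\<close>

lemma periodic_between_unblock:
  assumes "k \<ge> 1" and per: "periodic_between (blocks k u g) a b (k * q)" and "a + k * q \<le> b"
  shows "periodic_between g (a div k) (b div k) q"
  unfolding periodic_between_def
proof (intro allI impI)
  fix l assume l: "a div k \<le> l \<and> l + q \<le> b div k"
  \<comment> \<open>The first position of the block \<open>l\<close> that lies in the window.\<close>
  define j where "j = max a (k * l)"
  have "k * (l + q) \<le> k * (b div k)" using l by (intro mult_le_mono2) simp
  also have "\<dots> \<le> b" by simp
  finally have "k * l + k * q \<le> b" by (simp add: algebra_simps)
  then have eq: "blocks k u g j = blocks k u g (j + k * q)"
    using per assms(3) by (auto simp: periodic_between_def j_def)
  have "a < k * Suc (a div k)" using \<open>k \<ge> 1\<close> dividend_less_times_div[of k a] by simp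
  also have "\<dots> \<le> k * Suc l" using l by (intro mult_le_mono2) simp
  finally have "j div k = l" using \<open>k \<ge> 1\<close> by (intro div_nat_eqI) (auto simp: j_def)
  then show "g l = g (l + q)"
    using eq \<open>k \<ge> 1\<close> by (auto simp: blocks_def add.commute)
qed

section \<open>Parity and overlap-freeness of the Thue--Morse word\<close>

definition tm :: "nat \<Rightarrow> bool" where
  "tm n = thue_morse !! n"

lemma tm_rec: "tm n \<longleftrightarrow> tm (n div 2) \<noteq> odd n"
proof -
  have "morph tm_morph (Inf thue_morse) = Inf thue_morse"
    using theI'[OF thue_morse_ex1] unfolding thue_morse_def by blast
  then have "flat (smap tm_morph thue_morse) = thue_morse" by simp
  then show ?thesis unfolding tm_def by (metis flat_smap_tm_morph_snth)
qed

lemma tm_small: "\<not> tm 0" "tm (Suc 0)" "tm 2" "tm 4"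
proof -
  have "shd thue_morse = False"
    using theI'[OF thue_morse_ex1] unfolding thue_morse_def by blast
  then show 0: "\<not> tm 0" by (simp add: tm_def)
  then show 1: "tm (Suc 0)" using tm_rec[of "Suc 0"] by simp
  then show 2: "tm 2" using tm_rec[of 2] by simp
  show "tm 4" using tm_rec[of 4] 2 by simp
qed

lemma tm_eq_blocks: "tm = blocks 2 tm tm"
proof
  fix n
  have "tm (n mod 2) \<longleftrightarrow> odd n"
    by (cases "even n") (auto simp: tm_small odd_iff_mod_2_eq_one even_iff_mod_2_eq_zero)
  then show "tm n = blocks 2 tm tm n" using tm_rec[of n] by (auto simp: blocks_def)
qed

text \<open>
  This is \<open>h\<^bsub>2m\<^esub> = \<mu> \<circ> h\<^sub>m\<close>: a prefix of \<open>t\<close> of even length is the \<open>\<mu>\<close>-image of a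
  prefix of \<open>t\<close>.
\<close>

lemma blocks_even: "blocks (2 * m) tm g = blocks 2 tm (blocks m tm g)"
proof
  fix j
  have "j mod (2 * m) div 2 = j div 2 mod m" "j mod (2 * m) mod 2 = j mod 2"
    by (simp_all add: mod_mult2_eq)
  then have "tm (j mod (2 * m)) \<longleftrightarrow> tm (j mod 2) \<noteq> tm (j div 2 mod m)"
    using fun_cong[OF tm_eq_blocks, of "j mod (2 * m)"] by (simp add: blocks_def)
  then show "blocks (2 * m) tm g j = blocks 2 tm (blocks m tm g) j"
    by (auto simp: blocks_def div_mult2_eq)
qed

lemma equal_pair_in_tm_blocks_2: "blocks 2 tm g j = blocks 2 tm g (Suc j) \<Longrightarrow> odd j"
proof
  assume eq: "blocks 2 tm g j = blocks 2 tm g (Suc j)" and "even j"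
  then obtain c where "j = 2 * c" by (elim evenE)
  with eq show False
    using blocks_at[of 0 2 tm g c] blocks_at[of 1 2 tm g c] by (simp add: tm_small)
qed

lemma equal_pair_in_tm: "tm j = tm (Suc j) \<Longrightarrow> odd j"
  using equal_pair_in_tm_blocks_2[of tm j] tm_eq_blocks by simp

text \<open>
  The letters at \<open>a\<close> and \<open>a + p\<close> agree. As \<open>p\<close> is odd, the letters from \<open>a\<close> to \<open>a + p\<close> cannot
  alternate, so two adjacent ones are equal. Their translate by \<open>p\<close> starts at the other parity.
\<close>

lemma no_odd_overlap:
  fixes f :: "nat \<Rightarrow> bool"
  assumes pairs: "\<And>j. f j = f (Suc j) \<Longrightarrow> odd j"
    and "odd p" and per: "periodic_between f a (a + 2 * p) p"
  shows False
proof -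
  have eq: "f (j + p) = f j" if "a \<le> j" "j \<le> a + p" for j
    using periodic_betweenD[OF per] that by simp
  have "\<exists>i < p. f (a + i) = f (Suc (a + i))"
  proof (rule ccontr)
    assume "\<not> ?thesis"
    then have alt: "f (Suc (a + i)) \<longleftrightarrow> \<not> f (a + i)" if "i < p" for i
      using that by blast
    have "f (a + i) \<longleftrightarrow> f a = even i" if "i \<le> p" for i
      using that by (induction i) (auto simp: alt)
    from this[of p] eq[of a] \<open>odd p\<close> show False by auto
  qed
  then obtain i where i: "i < p" "f (a + i) = f (Suc (a + i))" by blast
  then have "f (a + i + p) = f (Suc (a + i + p))"
    using eq[of "a + i"] eq[of "Suc (a + i)"] by simp
  then have "odd (a + i + p)" "odd (a + i)" using pairs i by blast+
  then show False using \<open>odd p\<close> by simp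
qed

lemma tm_overlap_free:
  assumes "p \<ge> 1" "periodic_between tm a (a + 2 * p) p"
  shows False
  using assms
proof (induction p arbitrary: a rule: less_induct)
  case (less p)
  show False
  proof (cases "even p")
    case True
    then obtain q where q: "p = 2 * q" by (elim evenE)
    have "periodic_between tm (a div 2) ((a + 2 * p) div 2) q"
      using less.prems q tm_eq_blocks by (intro periodic_between_unblock[of 2 tm tm]) auto
    moreover have "(a + 2 * p) div 2 = a div 2 + 2 * q" using q by presburger
    ultimately show False using less.IH[of q "a div 2"] less.prems(1) q by simp
  next
    case False
    then show False using no_odd_overlap equal_pair_in_tm less.prems(2) by blast
  qed
qed

section \<open>Synchronization for odd block length\<close>

lemma equal_pair_in_tm_blocks:
  "blocks k tm g (k * c + r) = blocks k tm g (k * c + r + 1) \<Longrightarrow> r + 1 < k \<Longrightarrow> odd r"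
  using blocks_at[of r k tm g c] blocks_at[of "r + 1" k tm g c] equal_pair_in_tm[of r] by auto

lemma tm_block_start:
  assumes "k \<ge> 3"
  shows "blocks k tm g (k * c + 1) \<noteq> blocks k tm g (k * c)"
    and "blocks k tm g (k * c + 2) = blocks k tm g (k * c + 1)"
  using assms blocks_at[of 0 k tm g c] blocks_at[of 1 k tm g c] blocks_at[of 2 k tm g c]
  by (simp_all add: tm_small)

lemma overlap_not_in_block:
  assumes "p \<ge> 1" and per: "periodic_between (blocks k tm g) a b p"
    and "a \<le> x" "x + 2 * p \<le> b" "k * c \<le> x" "x + 2 * p < k * c + k"
  shows False
proof -
  have "tm j = tm (j + p)" if "x - k * c \<le> j" "j + p \<le> x - k * c + 2 * p" for j
  proof -
    have "a \<le> k * c + j" "k * c + j + p \<le> b" "j + p < k" using that assms by linarith+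
    then show ?thesis
      using periodic_betweenD[OF per, of "k * c + j"]
        blocks_at[of j k tm g c] blocks_at[of "j + p" k tm g c] by (auto simp: add.assoc)
  qed
  then have "periodic_between tm (x - k * c) (x - k * c + 2 * p) p"
    unfolding periodic_between_def by blast
  then show False using tm_overlap_free \<open>p \<ge> 1\<close> by blast
qed

text \<open>
  Suppose that an occurrence of a block starts in the block \<open>l\<close> at an offset \<open>d\<close> with
  \<open>0 < d < k\<close>, and so ends in the block \<open>l + 1\<close>. If the pair at offset 1 of the occurrence
  lies in the block \<open>l\<close>, then \<open>d\<close> is even; for \<open>d \<ge> 3\<close> the occurrence
  also contains the pair at offset 1 of the block \<open>l + 1\<close>, which makes \<open>d\<close> odd. The remaining offsets are \<open>2\<close>, \<open>k - 2\<close> and \<open>k - 1\<close>. A shift by 2 would make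
  \<open>t\<close> and its translate by 2 equal or complementary on their first three letters, which
  fails at the positions 0 and 2 because \<open>t\<close> starts with \<open>01101\<close>. For \<open>d = k - 1\<close> the pair of the
  occurrence would fall on the first two letters of the block \<open>l + 1\<close>, which differ. For \<open>k = 3\<close>
  and \<open>d = 1\<close> the first two letters of the occurrence would fall on the pair of the block \<open>l\<close>.
\<close>

lemma tm_block_synchronizes:
  fixes g :: "nat \<Rightarrow> bool" and k :: nat
  defines "H \<equiv> blocks k tm g"
  assumes "odd k" and occ: "\<And>j. j < k \<Longrightarrow> H (k * c + j) = H (e + j)"
  shows "k dvd e"
proof (rule ccontr)
  assume "\<not> k dvd e"
  define l where "l = e div k"
  define d where "d = e mod k"
  have e: "e = k * l + d" by (simp add: l_def d_def)
  have "k \<ge> 1" "k \<noteq> 1" "k \<noteq> 2" using \<open>odd k\<close> \<open>\<not> k dvd e\<close> by (auto simp: odd_pos Suc_le_eq)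
  then have k: "k \<ge> 3" by linarith
  have d: "0 < d" "d < k" using \<open>\<not> k dvd e\<close> k by (auto simp: d_def dvd_eq_mod_eq_0)
  have next_block: "k * (l + 1) + i = e + (k - d + i)" for i
    using d by (simp add: e)
  have start: "H (k * c' + 1) \<noteq> H (k * c')" "H (k * c' + 2) = H (k * c' + 1)" for c'
    using tm_block_start[OF k] by (simp_all add: H_def)
  have pair: "odd r" if "H (k * c' + r) = H (k * c' + r + 1)" "r + 1 < k" for c' r
    using equal_pair_in_tm_blocks that unfolding H_def by blast
  have at: "H (k * c' + r) \<longleftrightarrow> tm r \<noteq> g c'" if "r < k" for c' r
    using blocks_at[OF that] by (simp add: H_def)
  have e12: "H (e + 2) = H (e + 1)" "H (e + 1) \<noteq> H e"
    using occ[of 0] occ[of 1] occ[of 2] start[of c] k by auto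
  consider "d + 2 < k" | "d + 2 = k" "k \<ge> 5" | "d + 2 = k" "k = 3" | "d + 1 = k"
    using d k \<open>odd k\<close> by (cases "k = 4") (auto, linarith)
  then show False
  proof cases
    case 1
    have "even d" using pair[of l "d + 1"] e12 1 by (simp add: e add.assoc)
    show False
    proof (cases "d = 2")
      case True
      then have "k \<ge> 5" using 1 by simp
      then have "tm j \<noteq> g c \<longleftrightarrow> tm (j + 2) \<noteq> g l" if "j < 3" for j
        using occ[of j] at[of j c] at[of "j + 2" l] that True by (simp add: e algebra_simps)
      from this[of 0] this[of 2] show False by (simp add: tm_small flip: numeral_2_eq_2)
    next
      case False
      then have d4: "d \<ge> 3" using d \<open>even d\<close> by (cases "d = 1") auto
      have "H (e + (k - d + 2)) = H (e + (k - d + 1))"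
        using start(2)[of "l + 1"] next_block by metis
      then have "H (k * c + (k - d + 2)) = H (k * c + (k - d + 1))"
        using occ[of "k - d + 1"] occ[of "k - d + 2"] d4 d by simp
      then have "odd (k - d + 1)"
        using pair[of c "k - d + 1"] d4 d by (simp add: add.assoc)
      then show False using \<open>even d\<close> \<open>odd k\<close> d by simp
    qed
  next
    case 2
    have "tm (j + 2) \<noteq> g c \<longleftrightarrow> tm j \<noteq> g (l + 1)" if "j < 3" for j
    proof -
      have shift: "e + (j + 2) = k * (l + 1) + j" using 2 by (simp add: e algebra_simps)
      have "j + 2 < k" using that 2 by simp
      then have "H (k * c + (j + 2)) = H (k * (l + 1) + j)" using occ unfolding shift[symmetric]
        by blast
      then show ?thesis using at[of "j + 2" c] at[of j "l + 1"] that 2 by simp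
    qed
    from this[of 0] this[of 2] show False by (simp add: tm_small flip: numeral_2_eq_2)
  next
    case 3
    then show False using e12(2) at[of 1 l] at[of 2 l] by (simp add: e tm_small)
  next
    case 4
    then have "e + 1 = k * (l + 1)" by (simp add: e)
    then show False using start(1)[of "l + 1"] e12(1) by (metis add.assoc one_add_one)
  qed
qed

section \<open>Periods that are repeated more than three times\<close>

text \<open>
  With \<open>c\<close> the block in which the window starts and \<open>b\<close> the start of the next one, the cases are
  that the window meets one, two, or at least three blocks. Equal pairs within the block \<open>c\<close> start
  at an even distance from \<open>b\<close>, and those within the next block at an odd distance from \<open>b\<close>.

  In the case of two blocks, overlap-freeness leaves between \<open>p + 1\<close> and \<open>2 p\<close> letters on each side
  of \<open>b\<close>. Let \<open>p \<ge> 3\<close>; smaller periods contradict the beginning \<open>011\<close> of a block. Translating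
  the pair at \<open>b + 1\<close> to the left by \<open>p\<close> shows that \<open>p\<close> is odd. Then neither the
  translate by \<open>2 p\<close> to the left nor the one by \<open>p\<close> to the right can lie in the window, but the
  window is too long to avoid both.

  In the case of three blocks, the middle block is longer than \<open>p + 2\<close>, since otherwise it could be
  translated as a whole. The translate of the pair at \<open>b + 1\<close> to the right by \<open>p\<close> then stays in the
  middle block, and \<open>p\<close> is even. Parity now keeps two pairs out of the window: the translate by \<open>p\<close> to
  the left of the pair at \<open>b + 1\<close>, and the pair at offset 1 of the third block, whose translate to the
  left would lie in the middle block. At most \<open>p\<close> letters are left for the two outer blocks together,
  whereas overlap-freeness of the middle block requires \<open>p + 1\<close>.
\<close>

lemma cube_period_odd:
  fixes g :: "nat \<Rightarrow> bool" and k :: nat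
  defines "H \<equiv> blocks k tm g"
  assumes "odd k" "p \<ge> 1" and per: "periodic_between H a (a + 3 * p) p"
  shows "k dvd p"
proof (rule ccontr)
  assume ndvd: "\<not> k dvd p"
  have "k \<ge> 1" "k \<noteq> 1" "k \<noteq> 2" using \<open>odd k\<close> ndvd by (auto simp: odd_pos Suc_le_eq)
  then have k: "k \<ge> 3" by linarith
  have sync: False if "\<And>j. j < k \<Longrightarrow> H (k * c + j) = H (e + j)" "e + p = k * c \<or> e = k * c + p" for c e
  proof -
    have "k dvd e" using tm_block_synchronizes[OF \<open>odd k\<close>] that(1) unfolding H_def by blast
    then show False using that(2) ndvd by (metis dvd_add_right_iff dvd_triv_left)
  qed
  have eq: "H (j + p) = H j" if "a \<le> j" "j \<le> a + 2 * p" for j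
    using periodic_betweenD[OF per] that by simp
  have pair_left: "H (i - p) = H (i - p + 1)"
    if "H i = H (i + 1)" "a + p \<le> i" "i < a + 3 * p" for i
  proof -
    have "i - p + p = i" "i - p + 1 + p = i + 1" "a \<le> i - p" "i - p + 1 \<le> a + 2 * p"
      using that by linarith+
    then show ?thesis using eq[of "i - p"] eq[of "i - p + 1"] that(1) by simp
  qed
  have pair_right: "H (i + p) = H (i + p + 1)"
    if "H i = H (i + 1)" "a \<le> i" "i < a + 2 * p" for i
    using eq[of i] eq[of "i + 1"] that by simp
  have no_overlap: False if "a \<le> x" "x \<le> a + p" "k * c \<le> x" "x + 2 * p < k * c + k" for x c
    using overlap_not_in_block[OF \<open>p \<ge> 1\<close>] per that unfolding H_def by fastforce
  have start: "H (k * c + 1) \<noteq> H (k * c)" "H (k * c + 2) = H (k * c + 1)" for c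
    using tm_block_start[OF k] by (simp_all add: H_def)
  have pair: "odd r" if "H i = H (i + 1)" "i = k * c + r" "r + 1 < k" for c r i
    using equal_pair_in_tm_blocks that unfolding H_def by blast

  define c where "c = a div k"
  define b where "b = k * (c + 1)"
  have b: "b = k * c + k" by (simp add: b_def)
  have a: "k * c \<le> a" "a < b" 
    using k dividend_less_times_div[of k a] by (simp_all add: c_def b add.commute)
  consider "a + 3 * p < b" | "b \<le> a + 3 * p" "a + 3 * p < b + k" | "b + k \<le> a + 3 * p"
    by linarith
  then show False
  proof cases
    case 1
    then show False using no_overlap[of a c] a b by simp
  next
    case 2
    have "b \<le> a + 2 * p" by (rule ccontr) (use no_overlap[of a c] a b in simp)
    moreover have "a + p + 1 \<le> b"
      by (rule ccontr) (use no_overlap[of b "c + 1"] a b 2 in simp)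
    ultimately have r: "a + p + 1 \<le> b" "b \<le> a + 2 * p" by auto
    note startb = start[of "c + 1", folded b_def]
    consider "p = 1" | "p = 2" | "p \<ge> 3" using \<open>p \<ge> 1\<close> by linarith
    then show False
    proof cases
      case 1
      then show False using startb(1) eq[of b] r by simp
    next
      case 2
      then show False using startb eq[of b] r by simp
    next
      case 3
      have left: "H (b + 1 - p) = H (b + 1 - p + 1)"
        using pair_left[of "b + 1"] startb(2) r 3 by simp
      have "k \<ge> p" using a b r by linarith
      then have "odd (k + 1 - p)"
        using pair[OF left, of c "k + 1 - p"] b 3 by simp
      then have "odd p" using \<open>odd k\<close> \<open>k \<ge> p\<close> by simp
      show False
      proof (cases "a + 2 * p \<le> b + 1")
        case True
        have left2: "H (b + 1 - p - p) = H (b + 1 - p - p + 1)"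
          by (rule pair_left[OF left]) (use r 3 True in linarith)+
        have "k + 1 \<ge> 2 * p" using True a b by linarith
        then have "odd (k + 1 - 2 * p)"
          using pair[OF left2, of c "k + 1 - 2 * p"] b 3 by simp
        then show False using \<open>odd k\<close> \<open>k + 1 \<ge> 2 * p\<close> by simp
      next
        case False
        have right: "H (b + 1 + p) = H (b + 1 + p + 1)"
          using pair_right[of "b + 1"] startb(2) r False by simp
        have "odd (1 + p)"
          using pair[OF right, of "c + 1" "1 + p"] False b_def 2 by simp
        then show False using \<open>odd p\<close> by simp
      qed
    qed
  next
    case 3
    define e where "e = k * (c + 2)"
    have e: "e = b + k" by (simp add: e_def b_def)
    note startb = start[of "c + 1", folded b_def] and starte = start[of "c + 2", folded e_def]
    have "\<not> b + k \<le> a + 2 * p + 1"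
    proof
      assume "b + k \<le> a + 2 * p + 1"
      then have "H (b + j) = H (b + p + j)" if "j < k" for j
        using eq[of "b + j"] that a by (simp add: add_ac)
      then show False using sync[of "c + 1" "b + p"] by (simp add: b_def)
    qed
    moreover have "\<not> a + p \<le> b"
    proof
      assume "a + p \<le> b"
      then have "H (b + j) = H (b - p + j)" if "j < k" for j
        using eq[of "b - p + j"] that 3 by simp
      then show False using sync[of "c + 1" "b - p"] \<open>a + p \<le> b\<close> by (simp add: b_def)
    qed
    ultimately have bnd: "a + 2 * p + 1 < e" "b < a + p" by (auto simp: e)
    have kp: "p + 3 \<le> k" using bnd e by linarith
    have "k \<le> 2 * p" by (rule ccontr) (use no_overlap[of b "c + 1"] bnd a b in simp)
    have mid: "H (b + 1 + p) = H (b + 1 + p + 1)"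
      using pair_right[of "b + 1"] startb(2) bnd a kp \<open>k \<le> 2 * p\<close> by simp
    have "odd (1 + p)" using pair[OF mid, of "c + 1" "1 + p"] kp by (simp add: b_def)
    then have "even p" by simp
    have "b + 1 \<noteq> a + p"
    proof
      assume bap: "b + 1 = a + p"
      have left: "H (b + 1 - p) = H (b + 1 - p + 1)"
        using pair_left[of "b + 1"] startb(2) bap kp \<open>k \<le> 2 * p\<close> by simp
      have "odd (k + 1 - p)" using pair[OF left, of c "k + 1 - p"] b kp \<open>k \<le> 2 * p\<close> by simp
      then show False using \<open>odd k\<close> \<open>even p\<close> kp by simp
    qed
    then have "e + 2 \<le> a + 3 * p" using bnd e kp 3 \<open>k \<le> 2 * p\<close> by linarith
    then have right: "H (e + 1 - p) = H (e + 1 - p + 1)"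
      using pair_left[of "e + 1"] starte(2) bnd kp by simp
    have "odd (k + 1 - p)"
      using pair[OF right, of "c + 1" "k + 1 - p"] e b_def kp \<open>k \<le> 2 * p\<close> by simp
    then show False using \<open>odd k\<close> \<open>even p\<close> kp by simp
  qed
qed

text \<open>
  The bound of three periods and one letter survives the halving of \<open>k\<close>: the window from \<open>a\<close> to
  \<open>a + 6 q\<close> with period \<open>2 q\<close> becomes one from \<open>a div 2\<close> to \<open>a div 2 + 3 q\<close> with period \<open>q\<close>.
\<close>

lemma cube_period_dvd:
  assumes "k \<ge> 1" "p \<ge> 1" "periodic_between (blocks k tm g) a (a + 3 * p) p"
  shows "k dvd p"
  using assms
proof (induction k arbitrary: p a rule: less_induct)
  case (less k)
  show ?case
  proof (cases "even k")
    case True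
    then obtain m where m: "k = 2 * m" by (elim evenE)
    have per: "periodic_between (blocks 2 tm (blocks m tm g)) a (a + 3 * p) p"
      using less.prems(3) by (simp add: m blocks_even)
    have "even p"
    proof (rule ccontr)
      assume "odd p"
      moreover have "periodic_between (blocks 2 tm (blocks m tm g)) a (a + 2 * p) p"
        using per by (rule periodic_between_subset) simp_all
      ultimately show False using no_odd_overlap equal_pair_in_tm_blocks_2 by blast
    qed
    then obtain q where q: "p = 2 * q" by (elim evenE)
    have "periodic_between (blocks m tm g) (a div 2) ((a + 3 * p) div 2) q"
      using per q by (intro periodic_between_unblock[of 2]) auto
    moreover have "(a + 3 * p) div 2 = a div 2 + 3 * q" using q by presburger
    ultimately have "m dvd q"
      using less.IH[of m q "a div 2"] less.prems m q by simp
    then show ?thesis by (simp add: m q)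
  next
    case False
    then show ?thesis using cube_period_odd less.prems by blast
  qed
qed

section \<open>Critical exponents in terms of positions\<close>

primrec letter :: "'a fiword \<Rightarrow> nat \<Rightarrow> 'a" where
  "letter (Fin w) = (!) w"
| "letter (Inf s) = (!!) s"

primrec positions :: "'a fiword \<Rightarrow> nat set" where
  "positions (Fin w) = {..<length w}"
| "positions (Inf s) = UNIV"

lemma factors_eq_letter_intervals:
  "factors w - {[]} = {map (letter w) [a..<Suc b] | a b. a \<le> b \<and> b \<in> positions w}"
proof (cases w)
  case (Fin v)
  show ?thesis
  proof (intro equalityI subsetI)
    fix x assume "x \<in> factors w - {[]}"
    then obtain ps ss where v: "v = ps @ x @ ss" and "x \<noteq> []"
      by (auto simp: Fin sublist_def)
    then have "x = map (letter w) [length ps..<Suc (length ps + (length x - 1))]"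
      by (intro nth_equalityI) (auto simp: Fin nth_append simp del: upt_Suc)
    moreover have "length ps + (length x - 1) \<in> positions w"
      using v \<open>x \<noteq> []\<close> by (cases x) (simp_all add: Fin)
    ultimately show "x \<in> {map (letter w) [a..<Suc b] | a b. a \<le> b \<and> b \<in> positions w}"
      using le_add1 by blast
  next
    fix x assume "x \<in> {map (letter w) [a..<Suc b] | a b. a \<le> b \<and> b \<in> positions w}"
    then obtain a b where x: "x = map (letter w) [a..<Suc b]" and ab: "a \<le> b" "b < length v"
      by (auto simp: Fin)
    have "x = take (Suc b - a) (drop a v)"
      using ab by (intro nth_equalityI) (auto simp: x Fin simp del: upt_Suc)
    then have "sublist x v"
      by (metis sublist_drop sublist_take sublist_order.order_trans)
    then show "x \<in> factors w - {[]}" using ab by (simp add: Fin x)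
  qed
next
  case (Inf s)
  have *: "stake n (sdrop a s) = map (letter w) [a..<a + n]" for a n
    by (intro nth_equalityI) (auto simp: Inf sdrop_snth)
  show ?thesis
  proof (intro equalityI subsetI)
    fix x assume "x \<in> factors w - {[]}"
    then obtain a n where "x = stake n (sdrop a s)" "n \<noteq> 0"
      by (auto simp: Inf)
    then have "x = map (letter w) [a..<Suc (a + (n - 1))]" by (cases n) (simp_all add: * del: stake.simps)
    then show "x \<in> {map (letter w) [a..<Suc b] | a b. a \<le> b \<and> b \<in> positions w}"
      by (force simp: Inf)
  next
    fix x assume "x \<in> {map (letter w) [a..<Suc b] | a b. a \<le> b \<and> b \<in> positions w}"
    then obtain a b where x: "x = map (letter w) [a..<Suc b]" "a \<le> b" by blast
    then have "x = stake (Suc b - a) (sdrop a s)" by (simp add: * del: upt_Suc)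
    then show "x \<in> factors w - {[]}" using x by (auto simp: Inf)
  qed
qed

lemma is_period_letter_interval:
  "a \<le> b \<Longrightarrow> is_period (map f [a..<Suc b]) p \<longleftrightarrow>
     1 \<le> p \<and> p \<le> Suc b - a \<and> periodic_between f a b p"
proof -
  assume ab: "a \<le> b"
  have "(\<forall>i < Suc b - a - p. f (a + i) = f (a + (i + p))) \<longleftrightarrow> periodic_between f a b p"
    (is "?L \<longleftrightarrow> _") if "1 \<le> p"
  proof
    assume ?L
    show "periodic_between f a b p" unfolding periodic_between_def
    proof (intro allI impI)
      fix j assume j: "a \<le> j \<and> j + p \<le> b"
      then have "j - a < Suc b - a - p" by linarith
      with \<open>?L\<close>[rule_format, of "j - a"] j show "f j = f (j + p)" by simp
    qed
  next
    assume "periodic_between f a b p"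
    then show ?L by (auto simp: periodic_between_def add.assoc)
  qed
  then show ?thesis using ab by (auto simp: is_period_def simp del: upt_Suc)
qed

text \<open>
  The smallest period gives the largest quotient of length and period. So bounds on exponents can be
  tested on arbitrary periods, and no smallest period of a factor of an image has to be determined.
\<close>

lemma word_exp_le_iff:
  assumes "x \<noteq> []"
  shows "ereal (word_exp x) \<le> M \<longleftrightarrow>
    (\<forall>p. is_period x p \<longrightarrow> ereal (real (length x) / real p) \<le> M)"
proof
  have "is_period x (length x)"
    using assms by (auto simp: is_period_def Suc_le_eq)
  then have per: "is_period x (per x)" unfolding per_def by (rule LeastI)
  then show "ereal (word_exp x) \<le> M"
    if "\<forall>p. is_period x p \<longrightarrow> ereal (real (length x) / real p) \<le> M"
    using that by (simp add: word_exp_def)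
  show "\<forall>p. is_period x p \<longrightarrow> ereal (real (length x) / real p) \<le> M"
    if le: "ereal (word_exp x) \<le> M"
  proof (intro allI impI)
    fix p assume "is_period x p"
    then have "per x \<le> p" unfolding per_def by (rule Least_le)
    moreover have "1 \<le> per x" using per by (simp add: is_period_def)
    ultimately have "real (length x) / real p \<le> word_exp x"
      unfolding word_exp_def by (intro divide_left_mono) auto
    then have "ereal (real (length x) / real p) \<le> ereal (word_exp x)" by simp
    then show "ereal (real (length x) / real p) \<le> M" using le by (rule order_trans)
  qed
qed

lemma cexp_le_iff:
  "cexp w \<le> M \<longleftrightarrow> (\<forall>a b p. a \<le> b \<and> b \<in> positions w \<and> periodic_between (letter w) a b p \<and>
     1 \<le> p \<and> p \<le> Suc b - a \<longrightarrow> ereal (real (Suc b - a) / real p) \<le> M)"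
proof -
  have "ereal (word_exp (map (letter w) [a..<Suc b])) \<le> M \<longleftrightarrow>
      (\<forall>p. 1 \<le> p \<and> p \<le> Suc b - a \<and> periodic_between (letter w) a b p \<longrightarrow>
        ereal (real (Suc b - a) / real p) \<le> M)" if "a \<le> b" for a b
    using that
    by (subst word_exp_le_iff) (simp_all add: is_period_letter_interval del: upt_Suc)
  then show ?thesis
    unfolding cexp_def SUP_le_iff factors_eq_letter_intervals by blast
qed

section \<open>Truncated Thue--Morse morphisms as block codings\<close>

lemma length_trunc_tm: "length (trunc_tm k a) = k"
  by (simp add: trunc_tm_def)

lemma nth_trunc_tm: "r < k \<Longrightarrow> trunc_tm k a ! r \<longleftrightarrow> tm r \<noteq> a"
  by (simp add: trunc_tm_def tm_def)

lemma length_concat_map_uniform: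
  "(\<And>a. length (f a) = k) \<Longrightarrow> length (concat (map f v)) = k * length v"
  by (induction v) auto

lemma nth_concat_map_uniform:
  assumes "k \<ge> 1" "\<And>a. length (f a) = k" "j < k * length v"
  shows "concat (map f v) ! j = f (v ! (j div k)) ! (j mod k)"
  using assms(3)
proof (induction v arbitrary: j)
  case (Cons a v)
  show ?case
  proof (cases "j < k")
    case False
    then have "j div k = Suc ((j - k) div k)" "j mod k = (j - k) mod k"
      using assms(1) by (simp_all add: le_div_geq le_mod_geq)
    then show ?thesis using Cons False assms(2) by (simp add: nth_append)
  qed (simp add: nth_append assms)
qed simp

lemma snth_flat_smap_uniform:
  assumes "k \<ge> 1" "\<And>a. length (f a) = k"
  shows "flat (smap f s) !! j = f (s !! (j div k)) ! (j mod k)"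
proof (induction j arbitrary: s rule: less_induct)
  case (less j)
  have ne: "f (shd s) \<noteq> []" using assms(1) assms(2)[of "shd s"] by auto
  have fl: "flat (smap f s) = f (shd s) @- flat (smap f (stl s))"
    using flat_Stream[OF ne] by (metis stream.map_sel stream.collapse)
  show ?case
  proof (cases "j < k")
    case False
    then have "j div k = Suc ((j - k) div k)" "j mod k = (j - k) mod k"
      using assms(1) by (simp_all add: le_div_geq le_mod_geq)
    then show ?thesis
      using False assms less.IH[of "j - k" "stl s"] unfolding fl by (simp add: shift_snth)
  qed (simp add: fl shift_snth assms)
qed

lemma positions_trunc_tm:
  "k \<ge> 1 \<Longrightarrow> positions (morph (trunc_tm k) w) = {j. j div k \<in> positions w}"
  by (cases w) (auto simp: length_concat_map_uniform[OF length_trunc_tm] 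
      div_less_iff_less_mult mult.commute)

lemma letter_trunc_tm:
  "k \<ge> 1 \<Longrightarrow> j \<in> positions (morph (trunc_tm k) w) \<Longrightarrow>
     letter (morph (trunc_tm k) w) j = blocks k tm (letter w) j"
  by (cases w) (auto simp: length_concat_map_uniform[OF length_trunc_tm] blocks_def
      nth_concat_map_uniform[OF _ length_trunc_tm] snth_flat_smap_uniform[OF _ length_trunc_tm]
      nth_trunc_tm)

lemma positions_downward: "b \<in> positions w \<Longrightarrow> a \<le> b \<Longrightarrow> a \<in> positions w"
  by (cases w) auto

text \<open>
  For finite \<open>w\<close> the two words need not agree beyond the end of the image, where both depend on
  unspecified letters. Hence periods are compared only on windows that end inside it.
\<close>

lemma periodic_between_trunc_tm:
  assumes "k \<ge> 1" "b \<in> positions (morph (trunc_tm k) w)"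
  shows "periodic_between (letter (morph (trunc_tm k) w)) a b p \<longleftrightarrow>
         periodic_between (blocks k tm (letter w)) a b p"
proof -
  have "letter (morph (trunc_tm k) w) j = blocks k tm (letter w) j" if "j \<le> b" for j
    using letter_trunc_tm[OF assms(1)] positions_downward[OF assms(2) that] by blast
  then show ?thesis unfolding periodic_between_def by (metis add_leD1)
qed

section \<open>Comparing the critical exponents\<close>

lemma cexp_le_cexp_trunc_tm:
  assumes k: "k \<ge> 1"
  shows "cexp w \<le> cexp (morph (trunc_tm k) w)"
  unfolding cexp_le_iff[of w]
proof (intro allI impI; elim conjE)
  fix a b p assume ab: "a \<le> b" "b \<in> positions w" and per: "periodic_between (letter w) a b p"
    and p: "1 \<le> p" "p \<le> Suc b - a"
  let ?b = "k * b + (k - 1)"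
  have div: "?b div k = b" using k by (intro div_nat_eqI) auto
  have pos: "?b \<in> positions (morph (trunc_tm k) w)"
    using k ab div by (simp only: positions_trunc_tm mem_Collect_eq)
  have "periodic_between (blocks k tm (letter w)) (k * a) ?b (k * p)"
    unfolding periodic_between_def
  proof (intro allI impI)
    fix j assume j: "k * a \<le> j \<and> j + k * p \<le> ?b"
    have "a \<le> j div k" using j k by (simp add: less_eq_div_iff_mult_less_eq mult.commute)
    moreover have "(j + k * p) div k \<le> b" using div_le_mono[of "j + k * p" ?b k] j unfolding div by blast
    then have "j div k + p \<le> b" using k by (simp add: add.commute)
    ultimately have "letter w (j div k) = letter w (j div k + p)"
      using per k by (auto simp: periodic_between_def)
    then show "blocks k tm (letter w) j = blocks k tm (letter w) (j + k * p)"
      using k by (simp add: blocks_def add.commute)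
  qed
  then have per': "periodic_between (letter (morph (trunc_tm k) w)) (k * a) ?b (k * p)"
    using periodic_between_trunc_tm[OF k pos] by blast
  have len: "Suc ?b - k * a = k * (Suc b - a)" using k ab by (simp add: diff_mult_distrib2)
  have "k * a \<le> ?b" using ab by (simp add: trans_le_add1)
  moreover have "1 \<le> k * p" using k p by simp
  moreover have "k * p \<le> Suc ?b - k * a" unfolding len using p by simp
  ultimately have "ereal (real (Suc ?b - k * a) / real (k * p)) \<le> cexp (morph (trunc_tm k) w)"
    using cexp_le_iff[THEN iffD1, OF order_refl] pos per' by blast
  then show "ereal (real (Suc b - a) / real p) \<le> cexp (morph (trunc_tm k) w)"
    unfolding len using k by simp
qed

lemma cexp_trunc_tm_le:
  assumes k: "k \<ge> 1"
  shows "cexp (morph (trunc_tm k) w) \<le> max 3 (cexp w)"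
  unfolding cexp_le_iff[of "morph (trunc_tm k) w"]
proof (intro allI impI; elim conjE)
  fix a b p assume ab: "a \<le> b" and pos: "b \<in> positions (morph (trunc_tm k) w)"
    and "periodic_between (letter (morph (trunc_tm k) w)) a b p" and p: "1 \<le> p" "p \<le> Suc b - a"
  then have per: "periodic_between (blocks k tm (letter w)) a b p"
    using periodic_between_trunc_tm[OF k] by blast
  show "ereal (real (Suc b - a) / real p) \<le> max 3 (cexp w)"
  proof (cases "Suc b - a \<le> 3 * p")
    case True
    then have "real (Suc b - a) / real p \<le> 3" using p by (simp add: divide_le_eq)
    then have "ereal (real (Suc b - a) / real p) \<le> 3" by simp
    then show ?thesis by (simp add: le_max_iff_disj)
  next
    case False
    then have long: "a + 3 * p \<le> b" using ab by simp
    have "k dvd p"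
      using cube_period_dvd[OF k p(1)] periodic_between_subset[OF per le_refl long] by blast
    then obtain q where q: "p = k * q" by (elim dvdE)
    have "1 \<le> q" using q p by (cases q) auto
    let ?a = "a div k" and ?b = "b div k"
    have per': "periodic_between (letter w) ?a ?b q"
      using per long unfolding q by (intro periodic_between_unblock[OF k]) auto
    have "k * ?a \<le> a" "b < k * Suc ?b" using k dividend_less_times_div[of k b] by simp_all
    then have len: "Suc b - a \<le> k * (Suc ?b - ?a)"
      unfolding diff_mult_distrib2 by linarith
    have "k * q \<le> k * (Suc ?b - ?a)" using len p(2) unfolding q by linarith
    then have "q \<le> Suc ?b - ?a" using k by simp
    moreover have "?a \<le> ?b" using ab by (rule div_le_mono)
    moreover have "?b \<in> positions w" using pos k by (simp add: positions_trunc_tm)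
    ultimately have "ereal (real (Suc ?b - ?a) / real q) \<le> cexp w"
      using cexp_le_iff[THEN iffD1, OF order_refl] per' \<open>1 \<le> q\<close> by blast
    moreover have "real (Suc b - a) / real p \<le> real (Suc ?b - ?a) / real q"
    proof -
      have "real (Suc b - a) \<le> real k * real (Suc ?b - ?a)"
        using len by (metis of_nat_le_iff of_nat_mult)
      then show ?thesis using k \<open>1 \<le> q\<close> by (simp add: q divide_simps) (simp add: mult_ac mult_left_mono)
    qed
    ultimately show ?thesis by (meson ereal_less_eq(3) le_max_iff_disj order_trans)
  qed
qed

theorem theorem10:
  fixes w :: "bool fiword" and k :: nat
  assumes "w \<noteq> Fin []" and "k \<ge> 1"
  shows "(cexp w \<ge> 3 \<longrightarrow> cexp (morph (trunc_tm k) w) = cexp w) \<and>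
         (cexp w < 3 \<longrightarrow> cexp (morph (trunc_tm k) w) \<le> 3)"
  using cexp_le_cexp_trunc_tm[OF assms(2), of w] cexp_trunc_tm_le[OF assms(2), of w]
  by (auto simp: max_def split: if_splits)

end
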